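(* Let $p$ be a real number satisfying $0<p<1$ and let $\lambda$ be a nonzero real number. Then for all integers $n,l\ge 0$ the following orthogonality relations hold: $$\sum_{k=l}^{n}\sum_{j=0}^{k}\sum_{m=l}^{k}(-1)^{j}\frac{1}{k!}\binom{k}{j}\binom{k}{m}(k-1)_{k-m}\Big(\frac{p}{p-1}\Big)^{m}H_{n}^{(j)}\Big(\frac{1}{1-p} \Big)S_{1}(m,l)=\delta_{n,l},$$ $$\sum_{k=l}^{n}\sum_{j=k}^{n}\sum_{m=0}^{l}(-1)^{m}\frac{1}{l!}\binom{n}{j}\binom{l}{m}(n-1)_{n-j}\Big(\frac{p}{p-1}\Big)^{j}(p-1)^{n-l}S_{1}(j,k)H_{k}^{(m)}\Big(\frac{1}{1-p}\Big)=\delta_{n,l},$$ $$\sum_{k=l}^{n}\sum_{j=0}^{k}\sum_{m=l}^{k}(-1)^{j}\frac{1}{k!}\binom{k}{j}\binom{k}{m}(k-1)_{k-m}\Big(\frac{p}{p-1}\Big)^{m}h_{n,\lambda}^{(j)}\Big(\frac{1}{1-p} \Big)S_{1,\lambda}(m,l)=\delta_{n,l},$$ $$\sum_{k=l}^{n}\sum_{j=k}^{n}\sum_{m=0}^{l}(-1)^{m}\frac{1}{l!}\binom{n}{j}\binom{l}{m}(n-1)_{n-j}\Big(\frac{p}{p-1}\Big)^{j}(p-1)^{n-l}S_{1,\lambda}(j,k)h_{k,\lambda}^{(m)}\Big(\frac{1}{1-p}\Big)=\delta_{n,l},$$ where $H_{n}^{(j)}(u)$ are the Frobenius-Euler numbers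 of order $j$ and $h_{n,\lambda}^{(j)}(u)$ are the degenerate Frobenius-Euler numbers of order $j$.
   Context: $(x)_0=1$, $(x)_n=x(x-1)\cdots(x-n+1)$ for $n\ge1$. $S_1(n,k)$ are the (signed) Stirling numbers of the first kind: $\frac{1}{k!}(\log(1+t))^k=\sum_{n\ge k}S_1(n,k)\frac{t^n}{n!}$. For nonzero real $\lambda$: $e_\lambda(t)=(1+\lambda t)^{1/\lambda}$ and $\log_\lambda(t)=\frac1\lambda(t^\lambda-1)$; the degenerate Stirling numbers of the first kind are defined by $\frac{1}{k!}(\log_\lambda(1+t))^k=\sum_{n\ge k}S_{1,\lambda}(n,k)\frac{t^n}{n!}$. For an integer $r\ge0$ and $u\ne1$, $\big(\frac{1-u}{e^t-u}\big)^r=\sum_{n\ge0}H_n^{(r)}(u)\frac{t^n}{n!}$ and $\big(\frac{1-u}{e_\lambda(t)-u}\big)^r=\sum_{n\ge0}h_{n,\lambda}^{(r)}(u)\frac{t^n}{n!}$ define the (degenerate) Frobenius-Euler numbers of order $r$. $\delta_{n,l}$ is the Kronecker delta; empty sums are $0$. *)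

theory Defs
  imports "HOL-Computational_Algebra.Formal_Power_Series"
begin

definition falling :: "real \<Rightarrow> nat \<Rightarrow> real" where
  "falling x n = (\<Prod>i<n. x - real i)"

(* All generating functions are read as formal power series over the reals; a number given by
   F(t) = sum_n a_n t^n / n! is a_n = n! [t^n] F.  Here fps_ln 1 is log (1 + t) and
   fps_binomial a is (1 + t)^a. *)

definition S1 :: "nat \<Rightarrow> nat \<Rightarrow> real" where
  "S1 n k = fact n * fps_nth (fps_const (1 / fact k) * fps_ln 1 ^ k) n"

definition degen_exp :: "real \<Rightarrow> real fps" where
  "degen_exp lam = fps_binomial (1 / lam) oo (fps_const lam * fps_X)"

(* log_lam (1 + t), not log_lam t *)
definition degen_log1p :: "real \<Rightarrow> real fps" where
  "degen_log1p lam = fps_const (1 / lam) * (fps_binomial lam - 1)"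

definition S1_degen :: "real \<Rightarrow> nat \<Rightarrow> nat \<Rightarrow> real" where
  "S1_degen lam n k = fact n * fps_nth (fps_const (1 / fact k) * degen_log1p lam ^ k) n"

(* For u = 1 the denominators below are not invertible, so the definitions are meaningful
   only for u \<noteq> 1. *)

definition Frobenius_Euler :: "nat \<Rightarrow> nat \<Rightarrow> real \<Rightarrow> real" where
  "Frobenius_Euler r n u =
     fact n * fps_nth ((fps_const (1 - u) / (fps_exp 1 - fps_const u)) ^ r) n"

definition Frobenius_Euler_degen :: "real \<Rightarrow> nat \<Rightarrow> nat \<Rightarrow> real \<Rightarrow> real" where
  "Frobenius_Euler_degen lam r n u =
     fact n * fps_nth ((fps_const (1 - u) / (degen_exp lam - fps_const u)) ^ r) n"

(* The expansions of the first-kind Stirling series start at t^k. *)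

lemma fps_nth_power_below:
  fixes f :: "real fps"
  assumes "fps_nth f 0 = 0" "n < k"
  shows "fps_nth (f ^ k) n = 0"
  using assms by (meson startsby_zero_power_prefix)

lemma S1_below: "n < k \<Longrightarrow> S1 n k = 0"
  by (simp add: S1_def fps_nth_power_below)

lemma S1_degen_below: "n < k \<Longrightarrow> S1_degen lam n k = 0"
  by (simp add: S1_degen_def degen_log1p_def fps_nth_power_below)

end

theory Submission
  imports Defs
begin

text \<open>
  To a formal power series $f$ with $f(0) = 0$ attach the lower triangular array
  $T_f(n,k) = \frac{n!}{k!}\,[t^n] f^k$. Expanding $(f \circ g)^l = f^l \circ g$ in powers of $g$
  shows that composition of series becomes multiplication of arrays,
  $T_{f \circ g} = T_g \, T_f$ (lemma \<open>egf_array_compose\<close>). The array of $t$ is the identity, so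
  arrays of mutually inverse series are orthogonal. All four sums are such products.

  Put $q = 1 - u = p/(p-1)$ for $u = 1/(1-p)$, and let $E$ be $e^t - 1$ or $e_\lambda(t) - 1$, with
  compositional inverse $L$, which is $\log(1+t)$ or $\log_\lambda(1+t)$. Three arrays occur.

  \<^item> $T_L$ consists of the (degenerate) Stirling numbers of the first kind.
  \<^item> For $g = 1 - \frac{q}{E+q} = 1 - \frac{1-u}{E + 1 - u}$, expanding $g^k$ by the binomial theorem
    writes $T_g(n,k)$ as the alternating sum of (degenerate) Frobenius-Euler numbers over the
    order (lemma \<open>egf_array_one_minus\<close>).
  \<^item> For $h = \frac{qt}{1-t}$, the entries $T_h(k,m)$ are the Lah numbers
    $\binom{k}{m}(k-1)_{k-m}$ scaled by $q^m$ (lemma \<open>egf_array_Lah\<close>).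

  Now $h \circ g = q\,\frac{1 - q/(E+q)}{q/(E+q)} = E$. Hence $L \circ h$ is a left compositional
  inverse of $g$, and therefore a two-sided one. The first relation of each pair is
  $T_g \, (T_h \, T_L) = I$, the second is $(T_h \, T_L)\, T_g = I$. In the latter the factor
  $(p-1)^{n-l}$ equals $1$ on the diagonal and multiplies $0$ off it.
\<close>

section \<open>Arrays of power series\<close>

text \<open>
  For $f(0) = 0$ this is the iteration matrix of $f$: its entries are the partial Bell polynomials
  in the coefficients of the exponential generating function $f$.
\<close>

definition egf_array :: "real fps \<Rightarrow> nat \<Rightarrow> nat \<Rightarrow> real" where
  "egf_array f n k = fact n / fact k * fps_nth (f ^ k) n"

lemma egf_array_below:
  assumes "fps_nth f 0 = 0" "n < k"
  shows "egf_array f n k = 0"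
  using assms by (simp add: egf_array_def fps_nth_power_below)

lemma egf_array_X: "egf_array fps_X n l = (if n = l then 1 else 0)"
  by (simp add: egf_array_def fps_X_power_nth)

text \<open>
  This is the coefficient of $t^n$ in $(f \circ g)^l = f^l \circ g$: the factorials $k!$ cancel in
  the product. The sum may start at $k = l$ because $f^l$ starts at $t^l$.
\<close>

lemma egf_array_compose:
  assumes f0: "fps_nth f 0 = 0" and g0: "fps_nth g 0 = 0"
  shows "egf_array (f oo g) n l = (\<Sum>k=l..n. egf_array g n k * egf_array f k l)"
proof -
  have "egf_array (f oo g) n l = (\<Sum>k=0..n. egf_array g n k * egf_array f k l)"
    by (simp add: egf_array_def fps_compose_power[OF g0] fps_compose_nth sum_distrib_left
        mult_ac)
  also have "\<dots> = (\<Sum>k=l..n. egf_array g n k * egf_array f k l)"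
    by (rule sum.mono_neutral_right) (auto simp: egf_array_below[OF f0])
  finally show ?thesis .
qed

lemma egf_array_orthogonal:
  assumes "fps_nth f 0 = 0" "fps_nth g 0 = 0" "f oo g = fps_X"
  shows "(\<Sum>k=l..n. egf_array g n k * egf_array f k l) = (if n = l then 1 else 0)"
  using egf_array_compose[OF assms(1,2), of n l] by (simp add: assms(3) egf_array_X)

text \<open>
  A left inverse of $g$ forces $g'(0) \neq 0$, so $g$ has a genuine compositional inverse, and the
  two must agree.
\<close>

lemma fps_compose_eq_X_commute:
  fixes f g :: "real fps"
  assumes f0: "fps_nth f 0 = 0" and g0: "fps_nth g 0 = 0" and fg: "f oo g = fps_X"
  shows "g oo f = fps_X"
proof -
  have "fps_nth (f oo g) 1 = fps_nth f 1 * fps_nth g 1"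
    by (simp add: fps_compose_nth)
  then have g1: "fps_nth g 1 \<noteq> 0"
    using fg by auto
  have "f = f oo (g oo fps_inv g)"
    by (simp add: fps_inv_right[OF g0 g1])
  also have "\<dots> = f oo g oo fps_inv g"
    by (rule fps_compose_assoc) (simp_all add: g0 fps_inv_def)
  also have "\<dots> = fps_inv g"
    by (simp add: fg fps_inv_def)
  finally show ?thesis
    using fps_inv_right[OF g0 g1] by simp
qed

section \<open>Lah numbers and binomial expansions\<close>

text \<open>
  Substituting $-t$ into $(1+t)^{-m}$ and negating the upper index of the binomial
  coefficient gives a formula that holds for $m = 0$ as well.
\<close>

lemma fps_nth_inverse_one_minus_X_power:
  "fps_nth (inverse (1 - fps_X) ^ m :: real fps) n = (real n + real m - 1) gchoose n"
proof -
  have "(1 + fps_X) ^ m * fps_binomial (- real m) = (1 :: real fps)"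
    using fps_binomial_add_mult[of "real m" "- real m"]
    by (simp flip: fps_binomial_of_nat)
  then have "inverse ((1 + fps_X) ^ m) = fps_binomial (- real m)"
    by (rule fps_inverse_unique)
  moreover have "inverse ((1 + fps_X) ^ m) oo (- fps_X) = (inverse (1 - fps_X) ^ m :: real fps)"
    by (simp add: fps_inverse_compose fps_inverse_power fps_compose_add_distrib
        flip: fps_compose_power)
  ultimately have "inverse (1 - fps_X) ^ m = fps_binomial (- real m) oo (- fps_X)"
    by simp
  then show ?thesis
    by (simp add: fps_compose_uminus' gbinomial_negated_upper[of "- real m"] flip: mult.assoc)
qed

lemma gbinomial_eq_falling: "x gchoose n = falling x n / fact n"
  by (simp add: gbinomial_prod_rev falling_def atLeast0LessThan)

text \<open>
  The coefficient of $t^{k-m}$ in $(1-t)^{-m}$ is $(k-1)_{k-m}/(k-m)!$. The falling factorial is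
  taken at the real number $k-1$, so that $k = m = 0$ correctly gives $1$.
\<close>

lemma egf_array_Lah:
  assumes "m \<le> k"
  shows "egf_array (fps_const q * fps_X * inverse (1 - fps_X)) k m
    = real (k choose m) * falling (real k - 1) (k - m) * q ^ m"
proof -
  have "fps_nth ((fps_const q * fps_X * inverse (1 - fps_X)) ^ m) k
      = q ^ m * ((real k - 1) gchoose (k - m))"
    using assms
    by (simp add: power_mult_distrib mult.assoc fps_const_power fps_X_power_mult_nth
        fps_nth_inverse_one_minus_X_power of_nat_diff)
  then show ?thesis
    using assms by (simp add: egf_array_def gbinomial_eq_falling binomial_fact)
qed

lemma egf_array_one_minus:
  "egf_array (1 - A) n k
    = (\<Sum>j=0..k. (-1) ^ j * (1 / fact k) * real (k choose j) * (fact n * fps_nth (A ^ j) n))"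
proof -
  have "(1 - A) ^ k = (\<Sum>j\<le>k. of_nat (k choose j) * (- A) ^ j * 1 ^ (k - j))"
    using binomial_ring[of "- A" 1 k] by simp
  also have "\<dots> = (\<Sum>j=0..k. fps_const ((-1) ^ j * real (k choose j)) * A ^ j)"
    by (intro sum.cong) (auto simp: power_minus[of A] mult_ac simp flip: fps_of_nat
      fps_const_mult fps_const_power fps_const_neg)
  finally show ?thesis
    by (simp add: egf_array_def fps_sum_nth sum_distrib_left mult_ac)
qed

section \<open>The orthogonality relations for a general inverse pair\<close>

text \<open>
  With $A = q/(E+q)$, the identity $1 - A = E/(E+q)$ gives
  $\frac{q(1-A)}{A} = E$, that is $h \circ (1-A) = E$.
\<close>

lemma Lah_compose:
  fixes E :: "real fps"
  assumes E0: "fps_nth E 0 = 0" and q: "q \<noteq> 0"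
  shows "(fps_const q * fps_X * inverse (1 - fps_X)) oo (1 - fps_const q / (E + fps_const q)) = E"
proof -
  define A where "A = fps_const q / (E + fps_const q)"
  have D0: "fps_nth (E + fps_const q) 0 \<noteq> 0"
    using E0 q by simp
  have A: "A = fps_const q * inverse (E + fps_const q)"
    unfolding A_def using D0 by (rule fps_divide_unit)
  have AD: "A * (E + fps_const q) = fps_const q"
    unfolding A mult.assoc inverse_mult_eq_1[OF D0] by simp
  have A0: "fps_nth A 0 = 1"
    using E0 q by (simp add: A)
  have g0: "fps_nth (1 - A) 0 = 0"
    by (simp add: A0)
  have "(fps_const q * fps_X * inverse (1 - fps_X)) oo (1 - A)
      = fps_const q * (1 - A) * inverse A"
    by (simp add: fps_compose_mult_distrib[OF g0] fps_inverse_compose[OF g0]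
        fps_compose_sub_distrib A0)
  also have "fps_const q * (1 - A) = E * A"
    using AD by (simp add: algebra_simps)
  also have "E * A * inverse A = E"
    using inverse_mult_eq_1'[of A] by (simp add: A0 mult.assoc)
  finally show ?thesis
    by (simp add: A_def)
qed

text \<open>
  The classical and the degenerate case differ only in the inverse pair $(E, L)$.
  The first sum is an entry of $T_g \, (T_h \, T_L)$, the second one of $(T_h \, T_L)\, T_g$ times
  a power of $c$, which stands for $p - 1$.
\<close>

lemma Frobenius_Euler_Stirling_orthogonality:
  fixes E L :: "real fps" and q c :: real
  defines "H \<equiv> \<lambda>j n. fact n * fps_nth ((fps_const q / (E + fps_const q)) ^ j) n"
  assumes E0: "fps_nth E 0 = 0" and L0: "fps_nth L 0 = 0" and LE: "L oo E = fps_X"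
    and q: "q \<noteq> 0"
  shows "(\<Sum>k=l..n. \<Sum>j=0..k. \<Sum>m=l..k.
            (-1)^j * (1 / fact k) * real (k choose j) * real (k choose m)
            * falling (real k - 1) (k - m) * q^m * H j n * egf_array L m l)
          = (if n = l then 1 else 0)" (is "?first = _")
    and "(\<Sum>k=l..n. \<Sum>j=k..n. \<Sum>m=0..l.
            (-1)^m * (1 / fact l) * real (n choose j) * real (l choose m)
            * falling (real n - 1) (n - j) * q^j * c^(n - l)
            * egf_array L j k * H m k)
          = (if n = l then 1 else 0)" (is "?second = _")
proof -
  define h :: "real fps" where "h = fps_const q * fps_X * inverse (1 - fps_X)"
  define g where "g = 1 - fps_const q / (E + fps_const q)"
  define f where "f = L oo h"
  have h0: "fps_nth h 0 = 0"
    by (simp add: h_def)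
  have g0: "fps_nth g 0 = 0"
    using E0 q by (simp add: g_def fps_divide_unit)
  have f0: "fps_nth f 0 = 0"
    by (simp add: f_def L0)
  have "f oo g = L oo (h oo g)"
    unfolding f_def by (rule fps_compose_assoc[symmetric, OF g0 h0])
  also have "\<dots> = fps_X"
    unfolding h_def g_def by (simp add: Lah_compose[OF E0 q] LE)
  finally have fg: "f oo g = fps_X" .
  have gf: "g oo f = fps_X"
    by (rule fps_compose_eq_X_commute[OF f0 g0 fg])

  have T_g: "egf_array g n k
      = (\<Sum>j=0..k. (-1)^j * (1 / fact k) * real (k choose j) * H j n)" for n k
    unfolding g_def H_def by (rule egf_array_one_minus)
  have T_f: "egf_array f k l = (\<Sum>m=l..k. real (k choose m) * falling (real k - 1) (k - m)
      * q^m * egf_array L m l)" for k l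
    unfolding f_def egf_array_compose[OF L0 h0]
    by (intro sum.cong) (simp_all add: h_def egf_array_Lah)

  have "?first = (\<Sum>k=l..n. egf_array g n k * egf_array f k l)"
    unfolding T_g T_f sum_product by (intro sum.cong refl) (simp add: mult_ac)
  then show "?first = (if n = l then 1 else 0)"
    by (simp add: egf_array_orthogonal[OF f0 g0 fg])

  have "?second = c^(n - l) * (\<Sum>k=l..n. egf_array f n k * egf_array g k l)"
    unfolding T_g T_f sum_product
    by (subst sum_distrib_left, intro sum.cong refl) (simp add: sum_distrib_left mult_ac)
  then show "?second = (if n = l then 1 else 0)"
    by (simp add: egf_array_orthogonal[OF g0 f0 gf])
qed

section \<open>The classical and the degenerate pair\<close>

lemma S1_eq_egf_array: "S1 n k = egf_array (fps_ln 1) n k"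
  by (simp add: S1_def egf_array_def)

lemma S1_degen_eq_egf_array: "S1_degen lam n k = egf_array (degen_log1p lam) n k"
  by (simp add: S1_degen_def egf_array_def)

lemma degen_log1p_nth_0: "fps_nth (degen_log1p lam) 0 = 0"
  by (simp add: degen_log1p_def)

lemma ln_compose_exp: "fps_ln 1 oo (fps_exp 1 - 1) = (fps_X :: real fps)"
  by (simp add: fps_ln_fps_exp_inv fps_inv_fps_exp_compose)

text \<open>
  This is the power law $((1+t)^a)^{1/a} = 1 + t$. By the chain rule the left side $Z$
  satisfies $(1+t) Z' = Z$ and $Z(0) = 1$, which characterises the binomial series of exponent $1$.
\<close>

lemma fps_binomial_root_compose:
  fixes a :: real
  assumes a: "a \<noteq> 0"
  shows "fps_binomial (1 / a) oo (fps_binomial a - 1) = 1 + fps_X"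
proof -
  define Y where "Y = fps_binomial a - 1"
  define Z where "Z = fps_binomial (1 / a) oo Y"
  have Y0: "fps_nth Y 0 = 0"
    by (simp add: Y_def)
  have B: "fps_binomial a * inverse (fps_binomial a) = 1"
    by (rule inverse_mult_eq_1') simp
  have "fps_deriv Z = (fps_const (1 / a) * fps_binomial (1 / a) / (1 + fps_X) oo Y) * fps_deriv Y"
    by (simp add: Z_def fps_compose_deriv[OF Y0] fps_binomial_deriv)
  also have "fps_const (1 / a) * fps_binomial (1 / a) / (1 + fps_X) oo Y
      = fps_const (1 / a) * Z * inverse (fps_binomial a)"
    by (simp add: fps_divide_unit fps_compose_mult_distrib[OF Y0] fps_inverse_compose[OF Y0]
        fps_compose_add_distrib Y0 Z_def) (simp add: Y_def)
  also have "fps_deriv Y = fps_const a * fps_binomial a * inverse (1 + fps_X)"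
    by (simp add: Y_def fps_binomial_deriv fps_divide_unit)
  also have "fps_const (1 / a) * Z * inverse (fps_binomial a)
        * (fps_const a * fps_binomial a * inverse (1 + fps_X))
      = (fps_const (1 / a) * fps_const a) * (fps_binomial a * inverse (fps_binomial a))
        * Z * inverse (1 + fps_X)"
    by (simp only: mult_ac)
  also have "\<dots> = fps_const 1 * Z / (1 + fps_X)"
    using a by (simp add: B fps_divide_unit)
  finally have "Z = fps_const (fps_nth Z 0) * fps_binomial 1"
    by (rule iffD1[OF fps_binomial_ODE_unique])
  then show ?thesis
    using fps_binomial_of_nat[of 1, where ?'a = real] by (simp add: Z_def Y_def)
qed

text \<open>
  Composing $(1 + \lambda t)^{1/\lambda}$ with $\frac{1}{\lambda}((1+t)^\lambda - 1)$ gives $1 + t$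
  by the power law; the required composition in the other order follows since left inverses are
  two-sided.
\<close>

lemma degen_log1p_compose_degen_exp:
  assumes lam: "lam \<noteq> 0"
  shows "degen_log1p lam oo (degen_exp lam - 1) = fps_X"
proof (rule fps_compose_eq_X_commute)
  have L0: "fps_nth (degen_log1p lam) 0 = 0"
    by (rule degen_log1p_nth_0)
  have "degen_exp lam oo degen_log1p lam
      = fps_binomial (1 / lam) oo (fps_const lam * fps_X oo degen_log1p lam)"
    unfolding degen_exp_def by (rule fps_compose_assoc[symmetric]) (simp_all add: L0)
  also have "fps_const lam * fps_X oo degen_log1p lam = fps_const lam * degen_log1p lam"
    by (simp add: fps_compose_mult_distrib[OF L0] L0)
  also have "\<dots> = (fps_const lam * fps_const (1 / lam)) * (fps_binomial lam - 1)"
    by (simp only: degen_log1p_def mult.assoc)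
  also have "\<dots> = fps_binomial lam - 1"
    using lam by simp
  also have "fps_binomial (1 / lam) oo (fps_binomial lam - 1) = 1 + fps_X"
    by (rule fps_binomial_root_compose[OF lam])
  finally show "(degen_exp lam - 1) oo degen_log1p lam = fps_X"
    by (simp add: fps_compose_sub_distrib)
qed (simp_all add: degen_exp_def degen_log1p_nth_0)

theorem proposition3p1:
  fixes p lam :: real and n l :: nat
  assumes "0 < p" and "p < 1" and "lam \<noteq> 0"
  shows "(\<Sum>k=l..n. \<Sum>j=0..k. \<Sum>m=l..k.
            (-1)^j * (1 / fact k) * real (k choose j) * real (k choose m)
            * falling (real k - 1) (k - m) * (p / (p - 1))^m
            * Frobenius_Euler j n (1 / (1 - p)) * S1 m l)
          = (if n = l then 1 else 0)
      \<and> (\<Sum>k=l..n. \<Sum>j=k..n. \<Sum>m=0..l.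
            (-1)^m * (1 / fact l) * real (n choose j) * real (l choose m)
            * falling (real n - 1) (n - j) * (p / (p - 1))^j * (p - 1)^(n - l)
            * S1 j k * Frobenius_Euler m k (1 / (1 - p)))
          = (if n = l then 1 else 0)
      \<and> (\<Sum>k=l..n. \<Sum>j=0..k. \<Sum>m=l..k.
            (-1)^j * (1 / fact k) * real (k choose j) * real (k choose m)
            * falling (real k - 1) (k - m) * (p / (p - 1))^m
            * Frobenius_Euler_degen lam j n (1 / (1 - p)) * S1_degen lam m l)
          = (if n = l then 1 else 0)
      \<and> (\<Sum>k=l..n. \<Sum>j=k..n. \<Sum>m=0..l.
            (-1)^m * (1 / fact l) * real (n choose j) * real (l choose m)
            * falling (real n - 1) (n - j) * (p / (p - 1))^j * (p - 1)^(n - l)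
            * S1_degen lam j k * Frobenius_Euler_degen lam m k (1 / (1 - p)))
          = (if n = l then 1 else 0)"
proof -
  \<comment> \<open>$q = 1 - u$ turns both $e^t - u$ and $e_\lambda(t) - u$ into $E + q$ with $E(0) = 0$.\<close>
  define q where "q = p / (p - 1)"
  have q: "q \<noteq> 0"
    using assms by (simp add: q_def)
  have u: "1 / (1 - p) = 1 - q"
    using assms by (simp add: q_def divide_simps)
  have E_plus_q: "F - fps_const (1 - q) = (F - 1) + fps_const q" for F :: "real fps"
    by (simp add: fps_const_sub[symmetric] del: fps_const_sub)
  have FE: "Frobenius_Euler j n (1 / (1 - p))
      = fact n * fps_nth ((fps_const q / ((fps_exp 1 - 1) + fps_const q)) ^ j) n" for j n
    unfolding Frobenius_Euler_def u E_plus_q by simp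
  have FE_degen: "Frobenius_Euler_degen lam j n (1 / (1 - p))
      = fact n * fps_nth ((fps_const q / ((degen_exp lam - 1) + fps_const q)) ^ j) n" for j n
    unfolding Frobenius_Euler_degen_def u E_plus_q by simp
  have exp0: "fps_nth (fps_exp 1 - 1 :: real fps) 0 = 0"
    by simp
  have degen_exp0: "fps_nth (degen_exp lam - 1) 0 = 0"
    by (simp add: degen_exp_def)
  note classical = Frobenius_Euler_Stirling_orthogonality[OF exp0 fps_ln_0 ln_compose_exp q]
  note degenerate = Frobenius_Euler_Stirling_orthogonality[OF degen_exp0 degen_log1p_nth_0
      degen_log1p_compose_degen_exp[OF assms(3)] q]
  show ?thesis
    unfolding q_def[symmetric] FE FE_degen S1_eq_egf_array S1_degen_eq_egf_array
    by (intro conjI classical degenerate)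
qed

end
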